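(* Let $n\ge 0$, let $\mathbf{w}$ be a generalized snake word of length $n$, and let $L(\mathbf{w};t)$ be the Ehrhart polynomial of the order polytope $\mathcal{O}(P(\mathbf{w}))$ of the generalized snake poset $P(\mathbf{w})$. Then: (1) the polynomial $(t+1)(t+2)\cdots(t+n+3)$ divides $L(\mathbf{w};t)$ (in $\mathbb{Q}[t]$); (2) $L(\mathbf{w};t)=L(\mathbf{w};-n-4-t)$; (3) all integer roots of $L(\mathbf{w};t)$ lie in the interval $[-n-4,0]$.
   Context: Generalized snake words: for $n\ge 0$, a generalized snake word of length $n$ is $\mathbf{w}=w_0w_1\cdots w_n$ where $w_0=\varepsilon$ is the empty letter and $w_i\in\{L,R\}$ for $1\le i\le n$. Generalized snake posets: $P(\mathbf{w})$ is defined recursively. $P(\varepsilon)$ is the poset on $\{0,1,2,3\}$ with cover relations $1\prec 0$, $2\prec 0$, $3\prec 1$, $3\prec 2$. For $n\ge 1$, $P(w_0w_1\cdots w_n)$ is $P(w_0\cdots w_{n-1})\cup\{2n+2,2n+3\}$ with the added cover relations $2n+3\prec 2n+1$, $2n+3\prec 2n+2$, and: $2n+2\prec 2n-1$ if ($n=1$ and $w_1=L$) or ($n\ge2$ and $w_{n-1}w_n\in\{RL,LR\}$); $2n+2\prec 2n$ if ($n=1$ and $w_1=R$) or ($n\ge 2$ and $w_{n-1}w_n\in\{LL,RR\}$). So $P(\mathbf{w})$ has $2n+4$ elements $0,1,\dots,2n+3$, maximum $0$, minimum $2n+3$. Order polytope: for a finite poset $P$, $\mathcal{O}(P)=\{x\in[0,1]^P: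 x_i\le x_j \text{ whenever } i<_P j\}\subset\mathbb{R}^P$. It is a lattice polytope of dimension $|P|$. Ehrhart polynomial: $L(\mathbf{w};t)$ is the polynomial with $L(\mathbf{w};t)=|t\,\mathcal{O}(P(\mathbf{w}))\cap\mathbb{Z}^{P(\mathbf{w})}|$ for all integers $t\ge 0$. *)

theory Defs
  imports Complex_Main "HOL-Library.FuncSet" "HOL-Computational_Algebra.Polynomial"
begin

section \<open>Generalized snake posets\<close>

datatype snake_letter = L | R

text \<open>
  A generalized snake word of length \<open>n\<close> is a list of \<open>n\<close> letters; the empty letter \<open>w\<^sub>0\<close> is left
  implicit, so \<open>w\<^sub>i\<close> (for \<open>1 \<le> i \<le> n\<close>) is the list entry with index \<open>i - 1\<close>.
\<close>

definition snake_word_letter :: "snake_letter list \<Rightarrow> nat \<Rightarrow> snake_letter" where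
  "snake_word_letter w i = w ! (i - 1)"

text \<open>
  \<open>snake_covers w n\<close> is the cover relation of the poset of the prefix \<open>w\<^sub>0 w\<^sub>1 \<dots> w\<^sub>n\<close> of \<open>w\<close>; a pair
  \<open>(i, j)\<close> stands for \<open>i \<prec> j\<close>. The recursion is meaningful for \<open>n \<le> length w\<close>.
\<close>

primrec snake_covers :: "snake_letter list \<Rightarrow> nat \<Rightarrow> (nat \<times> nat) set" where
  "snake_covers w 0 = {(1, 0), (2, 0), (3, 1), (3, 2)}"
| "snake_covers w (Suc m) =
    (let n = Suc m; v = snake_word_letter w in
      snake_covers w m
      \<union> {(2 * n + 3, 2 * n + 1), (2 * n + 3, 2 * n + 2)}
      \<union> (if n = 1 \<and> v n = L \<or> n \<ge> 2 \<and> (v (n - 1), v n) \<in> {(R, L), (L, R)}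
         then {(2 * n + 2, 2 * n - 1)} else {})
      \<union> (if n = 1 \<and> v n = R \<or> n \<ge> 2 \<and> (v (n - 1), v n) \<in> {(L, L), (R, R)}
         then {(2 * n + 2, 2 * n)} else {}))"

definition snake_carrier :: "snake_letter list \<Rightarrow> nat set" where
  "snake_carrier w = {0..2 * length w + 3}"

definition snake_less :: "snake_letter list \<Rightarrow> (nat \<times> nat) set" where
  "snake_less w = (snake_covers w (length w))\<^sup>+"


section \<open>Order polytopes and Ehrhart polynomials\<close>

text \<open>
  The space of real vectors indexed by a set \<open>P\<close> is represented by the functions that are
  \<open>undefined\<close> outside \<open>P\<close>, so that a vector is determined by its coordinates. A finite poset is
  given by its carrier \<open>P\<close> and its strict order \<open>r\<close>.
\<close>

definition order_polytope :: "'a set \<Rightarrow> ('a \<times> 'a) set \<Rightarrow> ('a \<Rightarrow> real) set" where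
  "order_polytope P r =
     {x \<in> P \<rightarrow>\<^sub>E {0..1}. \<forall>i\<in>P. \<forall>j\<in>P. (i, j) \<in> r \<longrightarrow> x i \<le> x j}"

definition dilate :: "'a set \<Rightarrow> real \<Rightarrow> ('a \<Rightarrow> real) set \<Rightarrow> ('a \<Rightarrow> real) set" where
  "dilate P t S = (\<lambda>x. \<lambda>i\<in>P. t * x i) ` S"

definition integer_lattice :: "'a set \<Rightarrow> ('a \<Rightarrow> real) set" where
  "integer_lattice P = P \<rightarrow>\<^sub>E \<int>"

text \<open>
  A polynomial is determined by its values at the natural numbers, so the description below is
  that of a unique polynomial whenever the lattice point counts are polynomial in \<open>t\<close>.
\<close>

definition ehrhart_polynomial :: "'a set \<Rightarrow> ('a \<Rightarrow> real) set \<Rightarrow> rat poly" where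
  "ehrhart_polynomial P S =
     (THE p. \<forall>t::nat. poly p (of_nat t) =
        of_nat (card (dilate P (real t) S \<inter> integer_lattice P)))"

definition snake_ehrhart :: "snake_letter list \<Rightarrow> rat poly" where
  "snake_ehrhart w =
     ehrhart_polynomial (snake_carrier w) (order_polytope (snake_carrier w) (snake_less w))"

end

theory Submission
  imports Defs
begin

text \<open>
  The lattice points of the \<open>t\<close>-th dilate of an order polytope are the order-preserving maps into the
  chain \<open>0 < 1 < \<dots> < t\<close>. Hence the Ehrhart polynomial at \<open>t\<close> is the order polynomial \<open>\<Omega>\<close> at \<open>t + 1\<close>,
  where \<open>\<Omega> m\<close> counts the order-preserving maps into a chain of \<open>m\<close> elements, and the result is a
  consequence of two facts.

  The first is Stanley's reciprocity theorem: up to the sign \<open>(- 1) ^ card P\<close>, the number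
  \<open>\<Omega> (- m)\<close> counts the \<^emph>\<open>strictly\<close> order-preserving maps into a chain of \<open>m\<close> elements
  (\<open>order_poly_reciprocity\<close>). Splitting off the elements that a map sends to the top of the chain
  expresses \<open>\<Omega> (x + 1)\<close> for a poset as the sum of \<open>\<Omega> x\<close> over all its lower sets, and similarly the
  number of strict maps as a sum over the lower sets whose complement consists of maximal elements.
  The two summation operators are inverse to each other up to signs, because alternating sums over
  the subsets of a nonempty set vanish (\<open>order_poly_shift_inverse\<close>); so the second recursion
  computes \<open>\<Omega>\<close> at negative arguments.

  The second is that the snake poset is graded with a least and a greatest element
  (\<open>snake_bounded_graded\<close>): the level of the element \<open>i\<close>, counted from the top, is
  \<open>(i + 1) div 2\<close>, and the rank of the poset is \<open>n + 2\<close>. In a graded poset of rank \<open>h\<close>, a strict map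
  rises by at least the rank difference, so there is none into a chain of at most \<open>h\<close> elements, and
  subtracting the rank turns the strict maps into a chain of \<open>m + h\<close> elements bijectively into the
  weak maps into a chain of \<open>m\<close> elements. By reciprocity \<open>\<Omega>\<close> vanishes at \<open>0, - 1, \<dots>, - h\<close> and
  satisfies \<open>\<Omega> (- h - x) = \<Omega> x\<close>, the number of elements of a snake poset being even. The Ehrhart
  polynomial is positive at the natural numbers, which excludes integer roots \<open>\<ge> 0\<close> and, by
  symmetry, integer roots \<open>\<le> - n - 4\<close>.
\<close>

section \<open>Polynomials\<close>

lemma poly_eq_if_eq_on_nats:
  fixes p q :: "'a::field_char_0 poly"
  assumes "\<And>m. poly p (of_nat m) = poly q (of_nat m)"
  shows "p = q"
proof (rule ccontr)
  assume "p \<noteq> q"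
  then have "finite {x. poly (p - q) x = 0}"
    by (intro poly_roots_finite) simp
  moreover have "range of_nat \<subseteq> {x. poly (p - q) x = 0}"
    using assms by auto
  moreover have "infinite (range (of_nat :: nat \<Rightarrow> 'a))"
    using infinite_UNIV_char_0 by (simp add: finite_image_iff inj_on_def)
  ultimately show False
    using finite_subset by blast
qed

lemma prod_linear_dvd_if_roots:
  fixes p :: "'a::field poly"
  assumes "finite A" "inj_on a A" "\<And>k. k \<in> A \<Longrightarrow> poly p (- a k) = 0"
  shows "(\<Prod>k\<in>A. [:a k, 1:]) dvd p"
  using assms
proof (induction A arbitrary: p rule: finite_induct)
  case (insert k A)
  have "[:a k, 1:] dvd p"
    using insert.prems(2)[of k] poly_eq_0_iff_dvd[of p "- a k"] by simp
  then obtain q where q: "p = [:a k, 1:] * q"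
    by (elim dvdE)
  have "poly q (- a j) = 0" if "j \<in> A" for j
  proof -
    have "a k \<noteq> a j"
      using insert.prems(1) insert.hyps(2) that by (auto simp: inj_on_def)
    then show ?thesis
      using insert.prems(2)[of j] that by (simp add: q)
  qed
  then have "(\<Prod>k\<in>A. [:a k, 1:]) dvd q"
    using insert.IH insert.prems(1) by (simp add: inj_on_def)
  then show ?case
    using insert.hyps by (simp add: q mult_dvd_mono del: mult_pCons_left)
qed simp

text \<open>
  The antidifference is built from the leading term downwards: a suitable multiple of
  \<open>x ^ (d + 1)\<close> has a difference with the same leading term as \<open>p\<close>.
\<close>

lemma antidifference_exists:
  fixes p :: "'a::field_char_0 poly"
  shows "\<exists>q. \<forall>x. poly q (x + 1) - poly q x = poly p x"
proof (induction "degree p" arbitrary: p rule: less_induct)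
  case less
  define d where "d = degree p"
  (* The difference of x ^ (d + 1) has leading term (d + 1) * x ^ d, so D agrees with p in degree d
     and subtracting it leaves a polynomial of smaller degree. *)
  define c where "c = lead_coeff p / of_nat (Suc d)"
  define D where "D = smult c ([:1, 1:] ^ Suc d) - smult c (monom 1 (Suc d))"
  have D: "poly D x = c * (x + 1) ^ Suc d - c * x ^ Suc d" for x
    by (simp only: D_def poly_diff poly_smult poly_power poly_monom) (simp add: add.commute)
  have high: "coeff (p - D) i = 0" if i: "i \<ge> d" for i
  proof -
    consider "i = d" | "i = Suc d" | "i > Suc d"
      using i by linarith
    then show ?thesis
    proof cases
      case 1
      have "(of_nat (Suc d) :: 'a) \<noteq> 0"
        by (rule of_nat_neq_0)
      then show ?thesis
        using 1 by (simp add: D_def coeff_linear_poly_power c_def d_def del: power_Suc of_nat_Suc)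
    next
      case 2
      then have "coeff p i = 0"
        by (simp add: d_def coeff_eq_0)
      with 2 show ?thesis
        by (simp add: D_def coeff_linear_poly_power del: power_Suc)
    next
      case 3
      have "degree (smult c ([:1, 1:] ^ Suc d)) \<le> Suc d"
        using degree_linear_power[of "1::'a" "Suc d"] degree_smult_le[of c "[:1, 1:] ^ Suc d"]
        by simp
      then have "coeff (smult c ([:1, 1:] ^ Suc d)) i = 0"
        using 3 by (intro coeff_eq_0) linarith
      moreover have "coeff p i = 0"
        using 3 by (simp add: d_def coeff_eq_0)
      ultimately show ?thesis
        using 3 by (simp add: D_def del: power_Suc coeff_smult) simp
    qed
  qed
  have "\<exists>q. \<forall>x. poly q (x + 1) - poly q x = poly (p - D) x"
  proof (cases "d = 0")
    case True
    then have "p - D = 0"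
      using high by (intro poly_eqI) simp
    then show ?thesis
      by (intro exI[of _ 0]) simp
  next
    case False
    then have "degree (p - D) < degree p"
      using high by (intro degree_lessI) (auto simp: d_def)
    then show ?thesis
      by (rule less)
  qed
  then obtain q where q: "\<And>x. poly q (x + 1) - poly q x = poly (p - D) x"
    by blast
  have "poly (q + monom c (Suc d)) (x + 1) - poly (q + monom c (Suc d)) x = poly p x" for x
    using q[of x] D[of x] by (simp add: poly_monom algebra_simps)
  then show ?case
    by blast
qed

lemma poly_if_difference_poly:
  fixes f :: "nat \<Rightarrow> 'a::field_char_0"
  assumes "\<And>m. f (Suc m) - f m = poly p (of_nat m)"
  shows "\<exists>q. \<forall>m. poly q (of_nat m) = f m"
proof -
  obtain q where q: "\<And>x. poly q (x + 1) - poly q x = poly p x"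
    using antidifference_exists[of p] by blast
  have "poly (q + [:f 0 - poly q 0:]) (of_nat m) = f m" for m
  proof (induction m)
    case (Suc m)
    then show ?case
      using q[of "of_nat m"] assms[of m] by (simp add: algebra_simps)
  qed simp
  then show ?thesis
    by blast
qed


section \<open>Order-preserving maps into chains\<close>

definition weak_maps :: "('a \<times> 'a) set \<Rightarrow> 'a set \<Rightarrow> nat \<Rightarrow> ('a \<Rightarrow> nat) set" where
  "weak_maps r I m = {f \<in> I \<rightarrow>\<^sub>E {..<m}. \<forall>i\<in>I. \<forall>j\<in>I. (i, j) \<in> r \<longrightarrow> f i \<le> f j}"

definition strict_maps :: "('a \<times> 'a) set \<Rightarrow> 'a set \<Rightarrow> nat \<Rightarrow> ('a \<Rightarrow> nat) set" where
  "strict_maps r I m = {f \<in> I \<rightarrow>\<^sub>E {..<m}. \<forall>i\<in>I. \<forall>j\<in>I. (i, j) \<in> r \<longrightarrow> f i < f j}"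

text \<open>
  Lower sets and maximal elements refer to the subposet induced on \<open>I\<close>. Only the relation \<open>r\<close> itself
  enters, which may thus be a cover relation as well as the strict order that it generates.
\<close>

definition lower_sets :: "('a \<times> 'a) set \<Rightarrow> 'a set \<Rightarrow> 'a set set" where
  "lower_sets r I = {J. J \<subseteq> I \<and> (\<forall>i\<in>I. \<forall>j\<in>J. (i, j) \<in> r \<longrightarrow> i \<in> J)}"

definition maximals :: "('a \<times> 'a) set \<Rightarrow> 'a set \<Rightarrow> 'a set" where
  "maximals r I = {i \<in> I. \<forall>j\<in>I. (i, j) \<notin> r}"

lemma finite_weak_maps: "finite I \<Longrightarrow> finite (weak_maps r I m)"
  by (rule finite_subset[of _ "I \<rightarrow>\<^sub>E {..<m}"]) (auto simp: weak_maps_def intro!: finite_PiE)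

lemma finite_lower_sets: "finite I \<Longrightarrow> finite (lower_sets r I)"
  by (rule finite_subset[of _ "Pow I"]) (auto simp: lower_sets_def)

lemma finite_maximals: "finite I \<Longrightarrow> finite (maximals r I)"
  by (simp add: maximals_def)

text \<open>
  A map into \<open>{..m}\<close> is determined by the set \<open>J\<close> of elements that it sends below \<open>m\<close> and by its
  restriction to \<open>J\<close>. If membership in \<open>X\<close> can be tested on these two data separately, then \<open>X\<close> is
  counted by summing over \<open>J\<close>. Weak and strict maps both have this property, each with its own
  family \<open>\<D>\<close> of admissible sets.
\<close>

lemma card_maps_Suc:
  assumes "finite I" "X \<subseteq> I \<rightarrow>\<^sub>E {..<Suc m}" "\<And>J. Y J \<subseteq> J \<rightarrow>\<^sub>E {..<m}"
    and \<D>: "\<D> \<subseteq> Pow I"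
    and X: "\<And>f. f \<in> I \<rightarrow>\<^sub>E {..<Suc m} \<Longrightarrow>
      f \<in> X \<longleftrightarrow> {i \<in> I. f i < m} \<in> \<D> \<and> restrict f {i \<in> I. f i < m} \<in> Y {i \<in> I. f i < m}"
  shows "card X = (\<Sum>J\<in>\<D>. card (Y J))"
proof -
  let ?low = "\<lambda>f. {i \<in> I. f i < m}"
  let ?ext = "\<lambda>J g. \<lambda>i\<in>I. if i \<in> J then g i else m"
  have ext: "?low (?ext J g) = J" "restrict (?ext J g) J = g" "?ext J g \<in> I \<rightarrow>\<^sub>E {..<Suc m}"
    if "J \<in> \<D>" "g \<in> Y J" for J g
  proof -
    have J: "J \<subseteq> I" and g: "g \<in> J \<rightarrow>\<^sub>E {..<m}"
      using that \<D> assms(3)[of J] by auto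
    from g have lt: "g i < m" if "i \<in> J" for i
      using that by auto
    show "?low (?ext J g) = J"
      using J lt by auto
    show "restrict (?ext J g) J = g"
      using J g by (auto simp: fun_eq_iff restrict_def PiE_def extensional_def)
    show "?ext J g \<in> I \<rightarrow>\<^sub>E {..<Suc m}"
      using lt by (auto simp: less_SucI)
  qed
  have "bij_betw (\<lambda>f. (?low f, restrict f (?low f))) X (Sigma \<D> Y)"
  proof (rule bij_betw_byWitness[where f' = "\<lambda>(J, g). ?ext J g"])
    show "\<forall>f\<in>X. (\<lambda>(J, g). ?ext J g) (?low f, restrict f (?low f)) = f"
    proof
      fix f assume "f \<in> X"
      then have f: "f \<in> I \<rightarrow>\<^sub>E {..<Suc m}"
        using assms(2) by blast
      have "f i = m" if "i \<in> I" "\<not> f i < m" for i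
        using PiE_mem[OF f that(1)] that(2) by simp
      then show "(\<lambda>(J, g). ?ext J g) (?low f, restrict f (?low f)) = f"
        using f by (auto simp: fun_eq_iff restrict_def PiE_def extensional_def)
    qed
    show "\<forall>p\<in>Sigma \<D> Y. (?low ((\<lambda>(J, g). ?ext J g) p),
        restrict ((\<lambda>(J, g). ?ext J g) p) (?low ((\<lambda>(J, g). ?ext J g) p))) = p"
    proof
      fix p assume "p \<in> Sigma \<D> Y"
      then obtain J g where p: "p = (J, g)" "J \<in> \<D>" "g \<in> Y J"
        by blast
      show "(?low ((\<lambda>(J, g). ?ext J g) p),
        restrict ((\<lambda>(J, g). ?ext J g) p) (?low ((\<lambda>(J, g). ?ext J g) p))) = p"
        unfolding p(1) prod.case ext(1)[OF p(2,3)] ext(2)[OF p(2,3)] ..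
    qed
    show "(\<lambda>f. (?low f, restrict f (?low f))) ` X \<subseteq> Sigma \<D> Y"
      using X assms(2) by blast
    show "(\<lambda>(J, g). ?ext J g) ` Sigma \<D> Y \<subseteq> X"
    proof clarify
      fix J g assume p: "J \<in> \<D>" "g \<in> Y J"
      show "?ext J g \<in> X"
        unfolding X[OF ext(3)[OF p]] ext(1)[OF p] ext(2)[OF p] using p ..
    qed
  qed
  then have "card X = card (Sigma \<D> Y)"
    by (rule bij_betw_same_card)
  also have "\<dots> = (\<Sum>J\<in>\<D>. card (Y J))"
  proof (rule card_SigmaI)
    show fin: "finite \<D>"
      by (rule finite_subset[OF \<D>]) (simp add: \<open>finite I\<close>)
    show "\<forall>J\<in>\<D>. finite (Y J)"
    proof
      fix J assume "J \<in> \<D>"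
      then have "finite J"
        using \<D> \<open>finite I\<close> finite_subset by blast
      then have "finite (J \<rightarrow>\<^sub>E {..<m})"
        by (simp add: finite_PiE)
      then show "finite (Y J)"
        using assms(3) finite_subset by blast
    qed
  qed
  finally show ?thesis .
qed

text \<open>
  The elements that an order-preserving map sends below the top of the chain form a lower set, and
  every extension of an order-preserving map on a lower set by the top value is order-preserving.
\<close>

lemma card_weak_maps_Suc:
  assumes "finite I"
  shows "card (weak_maps r I (Suc m)) = (\<Sum>J\<in>lower_sets r I. card (weak_maps r J m))"
proof (rule card_maps_Suc[OF assms])
  fix f assume f: "f \<in> I \<rightarrow>\<^sub>E {..<Suc m}"
  let ?J = "{i \<in> I. f i < m}"
  have top: "f i \<le> m" if "i \<in> I" for i
    using PiE_mem[OF f that] by simp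
  show "f \<in> weak_maps r I (Suc m) \<longleftrightarrow> ?J \<in> lower_sets r I \<and> restrict f ?J \<in> weak_maps r ?J m"
  proof
    assume "f \<in> weak_maps r I (Suc m)"
    then show "?J \<in> lower_sets r I \<and> restrict f ?J \<in> weak_maps r ?J m"
      by (fastforce simp: weak_maps_def lower_sets_def)
  next
    assume *: "?J \<in> lower_sets r I \<and> restrict f ?J \<in> weak_maps r ?J m"
    have "f i \<le> f j" if "i \<in> I" "j \<in> I" "(i, j) \<in> r" for i j
    proof (cases "j \<in> ?J")
      case True
      then have "i \<in> ?J"
        using * that by (auto simp: lower_sets_def)
      then show ?thesis
        using * True that(3) by (auto simp: weak_maps_def)
    next
      case False
      then show ?thesis
        using top[of i] that by simp
    qed
    then show "f \<in> weak_maps r I (Suc m)"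
      using f by (simp add: weak_maps_def)
  qed
qed (auto simp: weak_maps_def lower_sets_def)

text \<open>
  Under a strict map, the elements sent to the top of the chain have nothing above them; here \<open>A\<close> is
  the set of these elements.
\<close>

lemma card_strict_maps_Suc:
  assumes "finite I"
  shows "card (strict_maps r I (Suc m)) =
    (\<Sum>A\<in>Pow (maximals r I). card (strict_maps r (I - A) m))"
proof -
  let ?\<D> = "{J. J \<subseteq> I \<and> I - J \<subseteq> maximals r I}"
  have "card (strict_maps r I (Suc m)) = (\<Sum>J\<in>?\<D>. card (strict_maps r J m))"
  proof (rule card_maps_Suc[OF assms])
    fix f assume f: "f \<in> I \<rightarrow>\<^sub>E {..<Suc m}"
    let ?J = "{i \<in> I. f i < m}"
    have top: "f i = m" if "i \<in> I" "i \<notin> ?J" for i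
      using PiE_mem[OF f that(1)] that by simp
    show "f \<in> strict_maps r I (Suc m) \<longleftrightarrow> ?J \<in> ?\<D> \<and> restrict f ?J \<in> strict_maps r ?J m"
    proof
      assume "f \<in> strict_maps r I (Suc m)"
      then show "?J \<in> ?\<D> \<and> restrict f ?J \<in> strict_maps r ?J m"
        by (fastforce simp: strict_maps_def maximals_def)
    next
      assume *: "?J \<in> ?\<D> \<and> restrict f ?J \<in> strict_maps r ?J m"
      have "f i < f j" if "i \<in> I" "j \<in> I" "(i, j) \<in> r" for i j
      proof -
        have i: "i \<in> ?J"
          using * that by (auto simp: maximals_def)
        show ?thesis
        proof (cases "j \<in> ?J")
          case True
          then show ?thesis
            using * i that(3) by (auto simp: strict_maps_def)
        next
          case False
          then show ?thesis
            using i top[of j] that by simp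
        qed
      qed
      then show "f \<in> strict_maps r I (Suc m)"
        using f by (simp add: strict_maps_def)
    qed
  qed (auto simp: strict_maps_def)
  also have "\<dots> = (\<Sum>A\<in>Pow (maximals r I). card (strict_maps r (I - A) m))"
    by (rule sum.reindex_bij_witness[where i = "\<lambda>A. I - A" and j = "\<lambda>J. I - J"])
      (auto simp: maximals_def double_diff)
  finally show ?thesis .
qed


section \<open>Order polynomials and their reciprocity\<close>

definition order_poly :: "('a \<times> 'a) set \<Rightarrow> 'a set \<Rightarrow> rat poly" where
  "order_poly r I = (SOME p. \<forall>m. poly p (of_nat m) = of_nat (card (weak_maps r I m)))"

lemma lower_sets_self: "I \<in> lower_sets r I"
  by (auto simp: lower_sets_def)

text \<open>
  In \<open>card_weak_maps_Suc\<close> the lower set \<open>I\<close> itself contributes the count for \<open>m\<close>; all other lower sets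
  are smaller. So by induction the difference of the counting function is polynomial.
\<close>

lemma order_poly_exists:
  assumes "finite I"
  shows "\<exists>p :: rat poly. \<forall>m. poly p (of_nat m) = of_nat (card (weak_maps r I m))"
  using assms
proof (induction "card I" arbitrary: I rule: less_induct)
  case less
  let ?\<L> = "lower_sets r I - {I}"
  have "\<exists>p :: rat poly. \<forall>m. poly p (of_nat m) = of_nat (card (weak_maps r J m))" if "J \<in> ?\<L>" for J
  proof (rule less.hyps)
    have "J \<subset> I"
      using that by (auto simp: lower_sets_def)
    then show "card J < card I" "finite J"
      using less.prems by (auto intro: psubset_card_mono finite_subset)
  qed
  then obtain p :: "'a set \<Rightarrow> rat poly"
    where p: "\<And>J m. J \<in> ?\<L> \<Longrightarrow> poly (p J) (of_nat m) = of_nat (card (weak_maps r J m))"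
    by metis
  show ?case
  proof (rule poly_if_difference_poly[of _ "\<Sum>J\<in>?\<L>. p J"])
    fix m
    have "card (weak_maps r I (Suc m)) = card (weak_maps r I m) + (\<Sum>J\<in>?\<L>. card (weak_maps r J m))"
      using sum.remove[OF finite_lower_sets[OF less.prems] lower_sets_self]
      by (simp add: card_weak_maps_Suc[OF less.prems])
    then show "of_nat (card (weak_maps r I (Suc m))) - of_nat (card (weak_maps r I m)) =
        poly (\<Sum>J\<in>?\<L>. p J) (of_nat m)"
      by (simp add: poly_sum p)
  qed
qed

lemma poly_order_poly:
  "finite I \<Longrightarrow> poly (order_poly r I) (of_nat m) = of_nat (card (weak_maps r I m))"
  using someI_ex[OF order_poly_exists] unfolding order_poly_def by blast

text \<open>
  As an identity of polynomials, the recursion for the counts holds at every rational argument, in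
  particular at the negative ones.
\<close>

lemma order_poly_shift:
  assumes "finite I"
  shows "poly (order_poly r I) (x + 1) = (\<Sum>J\<in>lower_sets r I. poly (order_poly r J) x)"
proof -
  have "order_poly r I \<circ>\<^sub>p [:1, 1:] = (\<Sum>J\<in>lower_sets r I. order_poly r J)"
  proof (rule poly_eq_if_eq_on_nats)
    fix m
    have "poly (order_poly r I \<circ>\<^sub>p [:1, 1:]) (of_nat m) = poly (order_poly r I) (of_nat (Suc m))"
      by (simp add: poly_pcompose add.commute)
    also have "\<dots> = (\<Sum>J\<in>lower_sets r I. of_nat (card (weak_maps r J m)))"
      by (simp only: poly_order_poly[OF assms] card_weak_maps_Suc[OF assms] of_nat_sum)
    also have "\<dots> = poly (\<Sum>J\<in>lower_sets r I. order_poly r J) (of_nat m)"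
      unfolding poly_sum
    proof (rule sum.cong)
      fix J assume "J \<in> lower_sets r I"
      then have "finite J"
        using assms by (auto simp: lower_sets_def intro: finite_subset)
      then show "of_nat (card (weak_maps r J m)) = poly (order_poly r J) (of_nat m)"
        by (simp add: poly_order_poly)
    qed simp
    finally show "poly (order_poly r I \<circ>\<^sub>p [:1, 1:]) (of_nat m) = \<dots>" .
  qed
  then have "poly (order_poly r I \<circ>\<^sub>p [:1, 1:]) x = poly (\<Sum>J\<in>lower_sets r I. order_poly r J) x"
    by (rule arg_cong)
  then show ?thesis
    by (simp add: poly_pcompose poly_sum add.commute)
qed

text \<open>
  In a finite acyclic relation every element lies below a maximal one.
\<close>

lemma lower_set_containing_maximals:
  assumes "acyclic r" "finite I" "K \<in> lower_sets r I" "maximals r I \<subseteq> K"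
  shows "K = I"
proof -
  let ?s = "r \<inter> I \<times> I"
  have "finite ?s" "acyclic ?s"
    using assms(1,2) by (auto intro: acyclic_subset)
  then have wf: "wf (?s\<inverse>)"
    by (rule finite_acyclic_wf_converse)
  have "i \<in> I \<longrightarrow> i \<in> K" for i
  proof (induction i rule: wf_induct_rule[OF wf])
    case (1 i)
    show ?case
    proof
      assume i: "i \<in> I"
      show "i \<in> K"
      proof (cases "i \<in> maximals r I")
        case False
        then obtain j where "j \<in> I" "(i, j) \<in> r"
          using i by (auto simp: maximals_def)
        then have "j \<in> K"
          using 1 i by blast
        then show ?thesis
          using assms(3) i \<open>(i, j) \<in> r\<close> by (auto simp: lower_sets_def)
      qed (use assms(4) in blast)
    qed
  qed
  then show ?thesis
    using assms(3) by (auto simp: lower_sets_def)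
qed

lemma sum_alternating_Pow:
  assumes "finite S"
  shows "(\<Sum>A\<in>Pow S. (- 1) ^ card A) = (if S = {} then 1 else 0 :: 'a::comm_ring_1)"
proof -
  have "(\<Sum>A\<in>Pow S. (- 1) ^ card A) = (\<Prod>x\<in>S. 1 - 1 :: 'a)"
    by (subst prod_diff_conv_sum[OF assms]) simp
  then show ?thesis
    using assms by (simp add: power_0_left)
qed

text \<open>
  Removing maximal elements leaves a lower set of \<open>I\<close>, whose own lower sets are therefore lower in \<open>I\<close>.
\<close>

lemma lower_sets_Diff_maximals:
  assumes "A \<subseteq> maximals r I"
  shows "lower_sets r (I - A) = {K \<in> lower_sets r I. A \<inter> K = {}}"
  using assms by (fastforce simp: lower_sets_def maximals_def)

text \<open>
  This is Moebius inversion in the lattice of lower sets. Expanding the left-hand side with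
  \<open>order_poly_shift\<close>, the coefficient of the term for a lower set \<open>K\<close> is the alternating sum over all
  sets of maximal elements outside \<open>K\<close>. It vanishes unless \<open>K\<close> contains all maximal elements, that is,
  unless \<open>K = I\<close>.
\<close>

lemma order_poly_shift_inverse:
  assumes "acyclic r" "finite I"
  shows "(\<Sum>A\<in>Pow (maximals r I). (- 1) ^ card A * poly (order_poly r (I - A)) (x + 1)) =
    poly (order_poly r I) x"
proof -
  let ?M = "maximals r I" and ?\<L> = "lower_sets r I"
  let ?q = "\<lambda>K. poly (order_poly r K) x"
  have "(\<Sum>A\<in>Pow ?M. (- 1) ^ card A * poly (order_poly r (I - A)) (x + 1)) =
      (\<Sum>A\<in>Pow ?M. \<Sum>K | K \<in> ?\<L> \<and> A \<inter> K = {}. (- 1) ^ card A * ?q K)"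
  proof (rule sum.cong)
    fix A assume "A \<in> Pow ?M"
    then show "(- 1) ^ card A * poly (order_poly r (I - A)) (x + 1) =
        (\<Sum>K | K \<in> ?\<L> \<and> A \<inter> K = {}. (- 1) ^ card A * ?q K)"
      using assms(2) by (simp add: order_poly_shift lower_sets_Diff_maximals sum_distrib_left)
  qed simp
  also have "\<dots> = (\<Sum>K\<in>?\<L>. \<Sum>A | A \<in> Pow ?M \<and> A \<inter> K = {}. (- 1) ^ card A * ?q K)"
    using assms(2) by (intro sum.swap_restrict) (simp_all add: finite_maximals finite_lower_sets)
  also have "\<dots> = (\<Sum>K\<in>?\<L>. if K = I then ?q K else 0)"
  proof (rule sum.cong)
    fix K assume K: "K \<in> ?\<L>"
    have "{A. A \<in> Pow ?M \<and> A \<inter> K = {}} = Pow (?M - K)"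
      by blast
    then have "(\<Sum>A | A \<in> Pow ?M \<and> A \<inter> K = {}. (- 1) ^ card A * ?q K) =
        (\<Sum>A\<in>Pow (?M - K). (- 1) ^ card A) * ?q K"
      by (simp add: sum_distrib_right)
    also have "\<dots> = (if ?M - K = {} then ?q K else 0)"
      using assms(2) by (simp add: sum_alternating_Pow finite_maximals)
    also have "?M - K = {} \<longleftrightarrow> K = I"
      using lower_set_containing_maximals[OF assms K] by (auto simp: maximals_def)
    finally show "(\<Sum>A | A \<in> Pow ?M \<and> A \<inter> K = {}. (- 1) ^ card A * ?q K) =
        (if K = I then ?q K else 0)" .
  qed simp
  also have "\<dots> = ?q I"
    using assms(2) by (simp add: sum.delta' finite_lower_sets lower_sets_self)
  finally show ?thesis .
qed

text \<open>
  At \<open>0\<close> there is a map only on the empty poset, and weak and strict maps agree there. Solving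
  \<open>order_poly_shift_inverse\<close> for the value at \<open>x = - (m + 1)\<close> gives, after collecting signs,
  the recursion \<open>card_strict_maps_Suc\<close>.
\<close>

theorem order_poly_reciprocity:
  assumes "acyclic r" "finite I"
  shows "poly (order_poly r I) (- of_nat m) = (- 1) ^ card I * of_nat (card (strict_maps r I m))"
  using assms(2)
proof (induction m arbitrary: I)
  case 0
  have "poly (order_poly r I) 0 = of_nat (card (weak_maps r I 0))"
    using poly_order_poly[OF 0, of r 0] by simp
  then show ?case
    by (cases "I = {}") (auto simp: weak_maps_def strict_maps_def)
next
  case (Suc m)
  have "poly (order_poly r I) (- of_nat (Suc m)) =
      (\<Sum>A\<in>Pow (maximals r I). (- 1) ^ card A * poly (order_poly r (I - A)) (- of_nat m))"
    by (subst order_poly_shift_inverse[OF assms(1) Suc.prems, symmetric]) simp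
  also have "\<dots> = (\<Sum>A\<in>Pow (maximals r I).
      (- 1) ^ card I * of_nat (card (strict_maps r (I - A) m)))"
  proof (rule sum.cong)
    fix A assume "A \<in> Pow (maximals r I)"
    then have A: "A \<subseteq> I"
      by (auto simp: maximals_def)
    then have "card I = card A + card (I - A)"
      using Suc.prems by (simp add: card_Diff_subset card_mono finite_subset)
    then show "(- 1) ^ card A * poly (order_poly r (I - A)) (- of_nat m) =
        (- 1) ^ card I * of_nat (card (strict_maps r (I - A) m))"
      using Suc by (simp add: power_add)
  qed simp
  also have "\<dots> = (- 1) ^ card I * of_nat (card (strict_maps r I (Suc m)))"
    by (simp add: card_strict_maps_Suc[OF Suc.prems] sum_distrib_left)
  finally show ?case .
qed


section \<open>Graded posets with a least and a greatest element\<close>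

text \<open>
  Here \<open>r\<close> is the cover relation, \<open>\<rho>\<close> the rank function, and \<open>b\<close> and \<open>t\<close> are the least and the greatest
  element, so \<open>\<rho> t\<close> is the rank of the poset.
\<close>

locale bounded_graded =
  fixes P :: "'a set" and r :: "('a \<times> 'a) set" and \<rho> :: "'a \<Rightarrow> nat" and b t :: 'a
  assumes finite_P: "finite P"
    and r_subset: "r \<subseteq> P \<times> P"
    and rank_cover: "(i, j) \<in> r \<Longrightarrow> \<rho> j = Suc (\<rho> i)"
    and bottom: "b \<in> P" "i \<in> P \<Longrightarrow> (b, i) \<in> r\<^sup>*" "\<rho> b = 0"
    and top: "t \<in> P" "i \<in> P \<Longrightarrow> (i, t) \<in> r\<^sup>*"
begin

lemma rank_le_top: "i \<in> P \<Longrightarrow> \<rho> i \<le> \<rho> t"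
proof -
  have "(i, j) \<in> r\<^sup>* \<Longrightarrow> \<rho> i \<le> \<rho> j" for i j
    by (induction rule: rtrancl_induct) (auto dest: rank_cover)
  then show "i \<in> P \<Longrightarrow> \<rho> i \<le> \<rho> t"
    using top by blast
qed

lemma acyclic_covers: "acyclic r"
proof -
  have "(i, j) \<in> r\<^sup>+ \<Longrightarrow> \<rho> i < \<rho> j" for i j
    by (induction rule: trancl_induct) (auto dest: rank_cover)
  then show ?thesis
    by (force simp: acyclic_def)
qed

lemma strict_maps_rank_gap:
  assumes "f \<in> strict_maps r P m" "(i, j) \<in> r\<^sup>*"
  shows "f i + \<rho> j \<le> f j + \<rho> i"
  using assms(2)
proof (induction rule: rtrancl_induct)
  case (step j k)
  then have "f j < f k"
    using assms(1) r_subset by (auto simp: strict_maps_def)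
  then show ?case
    using step.IH rank_cover[OF step.hyps(2)] by simp
qed simp

lemma strict_maps_empty:
  assumes "m \<le> \<rho> t"
  shows "strict_maps r P m = {}"
proof -
  have False if f: "f \<in> strict_maps r P m" for f
  proof -
    have "f t < m"
      using f top(1) by (auto simp: strict_maps_def)
    then show False
      using strict_maps_rank_gap[OF f bottom(2)[OF top(1)]] bottom(3) assms by simp
  qed
  then show ?thesis
    by blast
qed

text \<open>
  Along a cover, strict increase of \<open>f\<close> is the same as weak increase of \<open>f - \<rho>\<close>. The bounds on the
  values of \<open>f - \<rho>\<close> come from comparing \<open>f\<close> with its values at the least and the greatest element.
\<close>

lemma card_strict_maps_add_rank:
  "card (strict_maps r P (m + \<rho> t)) = card (weak_maps r P m)"
proof -
  have le: "\<rho> i \<le> f i" and less: "f i < m + \<rho> i"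
    if f: "f \<in> strict_maps r P (m + \<rho> t)" and i: "i \<in> P" for f i
  proof -
    show "\<rho> i \<le> f i"
      using strict_maps_rank_gap[OF f bottom(2)[OF i]] bottom(3) by simp
    have "f t < m + \<rho> t"
      using f top(1) by (auto simp: strict_maps_def)
    then show "f i < m + \<rho> i"
      using strict_maps_rank_gap[OF f top(2)[OF i]] by simp
  qed
  have "bij_betw (\<lambda>f. \<lambda>i\<in>P. f i - \<rho> i) (strict_maps r P (m + \<rho> t)) (weak_maps r P m)"
  proof (rule bij_betw_byWitness[where f' = "\<lambda>g. \<lambda>i\<in>P. g i + \<rho> i"])
    show "\<forall>f\<in>strict_maps r P (m + \<rho> t). (\<lambda>i\<in>P. (\<lambda>i\<in>P. f i - \<rho> i) i + \<rho> i) = f"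
    proof
      fix f assume f: "f \<in> strict_maps r P (m + \<rho> t)"
      then have "f \<in> extensional P"
        by (simp add: strict_maps_def PiE_def)
      then show "(\<lambda>i\<in>P. (\<lambda>i\<in>P. f i - \<rho> i) i + \<rho> i) = f"
        using le[OF f] by (auto simp: fun_eq_iff restrict_def extensional_def)
    qed
    show "\<forall>g\<in>weak_maps r P m. (\<lambda>i\<in>P. (\<lambda>i\<in>P. g i + \<rho> i) i - \<rho> i) = g"
      by (auto simp: fun_eq_iff restrict_def weak_maps_def PiE_def extensional_def)
    show "(\<lambda>f. \<lambda>i\<in>P. f i - \<rho> i) ` strict_maps r P (m + \<rho> t) \<subseteq> weak_maps r P m"
    proof clarify
      fix f assume f: "f \<in> strict_maps r P (m + \<rho> t)"
      have "f i - \<rho> i < m" if "i \<in> P" for i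
        using le[OF f that] less[OF f that] by linarith
      moreover have "f i - \<rho> i \<le> f j - \<rho> j" if "i \<in> P" "j \<in> P" "(i, j) \<in> r" for i j
        using strict_maps_rank_gap[OF f r_into_rtrancl[OF that(3)]] le[OF f that(1)] by linarith
      ultimately show "(\<lambda>i\<in>P. f i - \<rho> i) \<in> weak_maps r P m"
        by (auto simp: weak_maps_def)
    qed
    show "(\<lambda>g. \<lambda>i\<in>P. g i + \<rho> i) ` weak_maps r P m \<subseteq> strict_maps r P (m + \<rho> t)"
    proof clarify
      fix g assume g: "g \<in> weak_maps r P m"
      have "g i + \<rho> i < m + \<rho> t" if "i \<in> P" for i
        using g that rank_le_top[OF that] by (auto simp: weak_maps_def intro: add_less_le_mono)
      moreover have "g i + \<rho> i < g j + \<rho> j" if "i \<in> P" "j \<in> P" "(i, j) \<in> r" for i j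
        using g that rank_cover[OF that(3)] by (auto simp: weak_maps_def le_imp_less_Suc)
      ultimately show "(\<lambda>i\<in>P. g i + \<rho> i) \<in> strict_maps r P (m + \<rho> t)"
        by (auto simp: strict_maps_def)
    qed
  qed
  then show ?thesis
    by (rule bij_betw_same_card)
qed

lemma order_poly_root:
  assumes "m \<le> \<rho> t"
  shows "poly (order_poly r P) (- of_nat m) = 0"
  by (simp add: order_poly_reciprocity[OF acyclic_covers finite_P] strict_maps_empty[OF assms])

lemma order_poly_symmetric:
  "order_poly r P \<circ>\<^sub>p [:- of_nat (\<rho> t), - 1:] = smult ((- 1) ^ card P) (order_poly r P)"
proof (rule poly_eq_if_eq_on_nats)
  fix m
  have "poly (order_poly r P \<circ>\<^sub>p [:- of_nat (\<rho> t), - 1:]) (of_nat m) =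
      poly (order_poly r P) (- of_nat (m + \<rho> t))"
    by (simp add: poly_pcompose algebra_simps)
  then show "poly (order_poly r P \<circ>\<^sub>p [:- of_nat (\<rho> t), - 1:]) (of_nat m) =
      poly (smult ((- 1) ^ card P) (order_poly r P)) (of_nat m)"
    by (simp only: order_poly_reciprocity[OF acyclic_covers finite_P] card_strict_maps_add_rank
        poly_smult poly_order_poly[OF finite_P])
qed

end


section \<open>Lattice points of dilated order polytopes\<close>

lemma order_polytope_trancl:
  assumes "r \<subseteq> P \<times> P"
  shows "order_polytope P (r\<^sup>+) = order_polytope P r"
proof -
  have "x i \<le> x j" if x: "x \<in> order_polytope P r" and "(i, j) \<in> r\<^sup>+" for x :: "'a \<Rightarrow> real" and i j
    using that(2)
  proof (induction rule: trancl_induct)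
    case (base j)
    then show ?case
      using x assms by (auto simp: order_polytope_def)
  next
    case (step j k)
    then have "x j \<le> x k"
      using x assms by (auto simp: order_polytope_def)
    then show ?case
      using step.IH by linarith
  qed
  then show ?thesis
    unfolding order_polytope_def by blast
qed

text \<open>
  A lattice point of the dilate is a natural-valued order-preserving function bounded by \<open>t\<close>.
\<close>

lemma card_lattice_points_order_polytope:
  "card (dilate P (real t) (order_polytope P r) \<inter> integer_lattice P) = card (weak_maps r P (Suc t))"
proof -
  let ?real = "\<lambda>f :: 'a \<Rightarrow> nat. \<lambda>i\<in>P. real (f i)"
  have "bij_betw ?real (weak_maps r P (Suc t))
    (dilate P (real t) (order_polytope P r) \<inter> integer_lattice P)"
    unfolding bij_betw_def
  proof
    show "inj_on ?real (weak_maps r P (Suc t))"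
    proof (rule inj_onI)
      fix f g assume "f \<in> weak_maps r P (Suc t)" "g \<in> weak_maps r P (Suc t)" and eq: "?real f = ?real g"
      then have "f \<in> extensional P" "g \<in> extensional P"
        by (auto simp: weak_maps_def PiE_def)
      then show "f = g"
      proof (rule extensionalityI)
        fix i assume "i \<in> P"
        then show "f i = g i"
          using fun_cong[OF eq, of i] by simp
      qed
    qed
    show "?real ` weak_maps r P (Suc t) =
      dilate P (real t) (order_polytope P r) \<inter> integer_lattice P"
    proof (intro equalityI subsetI)
      fix y assume "y \<in> ?real ` weak_maps r P (Suc t)"
      then obtain f where f: "f \<in> weak_maps r P (Suc t)" and y: "y = ?real f"
        by blast
      have bound: "f i \<le> t" if "i \<in> P" for i
        using f that by (auto simp: weak_maps_def less_Suc_eq_le)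
      (* For t = 0 the quotient is 0 by convention; this is harmless because then f vanishes on P. *)
      have "(\<lambda>i\<in>P. real (f i) / real t) \<in> order_polytope P r"
        using f bound
        by (auto simp: order_polytope_def weak_maps_def divide_le_eq_1 intro!: divide_right_mono)
      moreover have "y = (\<lambda>i\<in>P. real t * (\<lambda>i\<in>P. real (f i) / real t) i)"
        using bound by (auto simp: y fun_eq_iff restrict_def)
      ultimately have "y \<in> dilate P (real t) (order_polytope P r)"
        unfolding dilate_def by blast
      then show "y \<in> dilate P (real t) (order_polytope P r) \<inter> integer_lattice P"
        by (auto simp: y integer_lattice_def)
    next
      fix y assume "y \<in> dilate P (real t) (order_polytope P r) \<inter> integer_lattice P"
      then obtain x where x: "x \<in> order_polytope P r" and y: "y = (\<lambda>i\<in>P. real t * x i)"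
        and int: "y \<in> P \<rightarrow>\<^sub>E \<int>"
        by (auto simp: dilate_def integer_lattice_def)
      have x01: "0 \<le> x i" "x i \<le> 1" if "i \<in> P" for i
        using x that by (auto simp: order_polytope_def)
      define f where "f = (\<lambda>i\<in>P. nat \<lfloor>y i\<rfloor>)"
      have f: "real (f i) = real t * x i" if "i \<in> P" for i
      proof -
        have "real t * x i \<in> \<int>"
          using PiE_mem[OF int that] that by (simp add: y)
        then show ?thesis
          using x01(1)[OF that] that by (auto simp: f_def y elim!: Ints_cases)
      qed
      have "f i < Suc t" if "i \<in> P" for i
      proof -
        have "real (f i) \<le> real t"
          using f[OF that] x01[OF that] mult_left_le[of "x i" "real t"] by simp
        then show ?thesis
          by simp
      qed
      moreover have "f i \<le> f j" if "i \<in> P" "j \<in> P" "(i, j) \<in> r" for i j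
      proof -
        have "real (f i) \<le> real (f j)"
          using x that by (simp add: f order_polytope_def mult_left_mono)
        then show ?thesis
          by simp
      qed
      ultimately have "f \<in> weak_maps r P (Suc t)"
        by (auto simp: weak_maps_def f_def)
      moreover have "y = ?real f"
        using f by (auto simp: y fun_eq_iff restrict_def)
      ultimately show "y \<in> ?real ` weak_maps r P (Suc t)"
        by blast
    qed
  qed
  then show ?thesis
    by (metis bij_betw_same_card)
qed

lemma ehrhart_polynomial_order_polytope:
  assumes "finite P"
  shows "ehrhart_polynomial P (order_polytope P r) = order_poly r P \<circ>\<^sub>p [:1, 1:]"
  unfolding ehrhart_polynomial_def card_lattice_points_order_polytope
proof (rule the_equality)
  show *: "\<forall>t. poly (order_poly r P \<circ>\<^sub>p [:1, 1:]) (of_nat t) = of_nat (card (weak_maps r P (Suc t)))"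
  proof
    fix t
    have "poly (order_poly r P \<circ>\<^sub>p [:1, 1:]) (of_nat t) = poly (order_poly r P) (of_nat (Suc t))"
      by (simp add: poly_pcompose add.commute)
    then show "poly (order_poly r P \<circ>\<^sub>p [:1, 1:]) (of_nat t) = of_nat (card (weak_maps r P (Suc t)))"
      by (simp only: poly_order_poly[OF assms])
  qed
  fix p :: "rat poly"
  assume "\<forall>t. poly p (of_nat t) = of_nat (card (weak_maps r P (Suc t)))"
  then show "p = order_poly r P \<circ>\<^sub>p [:1, 1:]"
    using * by (intro poly_eq_if_eq_on_nats) simp
qed


section \<open>Generalized snake posets\<close>

lemma snake_covers_subset: "snake_covers w m \<subseteq> {0..2 * m + 3} \<times> {0..2 * m + 3}"
  by (induction m) (auto simp: Let_def)

text \<open>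
  Both middle elements \<open>2 k - 1\<close> and \<open>2 k\<close> of a square have level \<open>k\<close> counted from the top, whatever
  the word is; so each cover steps up by exactly one level.
\<close>

lemma snake_covers_level: "(i, j) \<in> snake_covers w m \<Longrightarrow> (i + 1) div 2 = Suc ((j + 1) div 2)"
  by (induction m) (auto simp: Let_def split: if_splits)

lemma snake_new_element_covered:
  "(2 * m + 4, 2 * m + 1) \<in> snake_covers w (Suc m) \<or> (2 * m + 4, 2 * m + 2) \<in> snake_covers w (Suc m)"
proof (cases "m = 0")
  case True
  then show ?thesis
    by (cases "snake_word_letter w 1") auto
next
  case False
  then show ?thesis
    by (cases "snake_word_letter w m"; cases "snake_word_letter w (Suc m)") (auto simp: Let_def)
qed

text \<open>
  The new minimum \<open>2 m + 5\<close> lies below the old one, and the other new element \<open>2 m + 4\<close> is attached to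
  an old element for every choice of letters. So adding a square keeps \<open>0\<close> as the greatest element
  and makes the new minimum the least one.
\<close>

lemma snake_bounded:
  "i \<le> 2 * m + 3 \<Longrightarrow> (2 * m + 3, i) \<in> (snake_covers w m)\<^sup>* \<and> (i, 0) \<in> (snake_covers w m)\<^sup>*"
proof (induction m arbitrary: i)
  case 0
  then consider "i = 0" | "i = 1" | "i = 2" | "i = 3"
    by fastforce
  moreover have "(3, 1) \<in> (snake_covers w 0)\<^sup>*" "(3, 2) \<in> (snake_covers w 0)\<^sup>*"
      "(1, 0) \<in> (snake_covers w 0)\<^sup>*" "(2, 0) \<in> (snake_covers w 0)\<^sup>*"
    by auto
  ultimately show ?case
    by cases (auto intro: rtrancl_trans simp del: snake_covers.simps)
next
  case (Suc m)
  let ?C = "snake_covers w (Suc m)"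
  have "(snake_covers w m)\<^sup>* \<subseteq> ?C\<^sup>*"
    by (rule rtrancl_mono) (auto simp: Let_def)
  then have old: "(2 * m + 3, j) \<in> ?C\<^sup>*" "(j, 0) \<in> ?C\<^sup>*" if "j \<le> 2 * m + 3" for j
    using Suc.IH[OF that] by auto
  have new: "(2 * m + 5, 2 * m + 3) \<in> ?C" "(2 * m + 5, 2 * m + 4) \<in> ?C"
    by (auto simp: Let_def)
  have "(2 * m + 4, 0) \<in> ?C\<^sup>*"
    using snake_new_element_covered[of m w] old(2)[of "2 * m + 1"] old(2)[of "2 * m + 2"]
    by (auto intro: converse_rtrancl_into_rtrancl)
  moreover have "(2 * m + 5, 0) \<in> ?C\<^sup>*"
    using new(1) old(2)[of "2 * m + 3"] by (simp add: converse_rtrancl_into_rtrancl)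
  moreover have "(2 * m + 5, j) \<in> ?C\<^sup>*" if "j \<le> 2 * m + 3" for j
    using new(1) old(1)[OF that] by (rule converse_rtrancl_into_rtrancl)
  moreover have "(2 * m + 5, 2 * m + 4) \<in> ?C\<^sup>*"
    using new(2) by (rule r_into_rtrancl)
  moreover from Suc.prems have "i \<le> 2 * m + 3 \<or> i = 2 * m + 4 \<or> i = 2 * m + 5"
    by auto
  moreover have bottom: "2 * Suc m + 3 = 2 * m + 5"
    by simp
  ultimately show ?case
    unfolding bottom using old(2) by blast
qed

lemma snake_bounded_graded:
  "bounded_graded {0..2 * n + 3} (snake_covers w n) (\<lambda>i. n + 2 - (i + 1) div 2) (2 * n + 3) 0"
proof
  show "snake_covers w n \<subseteq> {0..2 * n + 3} \<times> {0..2 * n + 3}"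
    by (rule snake_covers_subset)
  show "n + 2 - (j + 1) div 2 = Suc (n + 2 - (i + 1) div 2)" if "(i, j) \<in> snake_covers w n" for i j
  proof -
    have "i \<le> 2 * n + 3"
      using that snake_covers_subset by fastforce
    then have "(i + 1) div 2 \<le> n + 2"
      by simp
    then show ?thesis
      using snake_covers_level[OF that] by linarith
  qed
qed (use snake_bounded[of _ n w] in auto)

theorem theorem2p9:
  fixes n :: nat and w :: "snake_letter list"
  assumes "length w = n"
  shows "(\<Prod>k = 1..n + 3. [:of_nat k, 1:]) dvd snake_ehrhart w
    \<and> snake_ehrhart w = snake_ehrhart w \<circ>\<^sub>p [:- of_nat n - 4, - 1:]
    \<and> (\<forall>r::int. poly (snake_ehrhart w) (of_int r) = 0 \<longrightarrow> r \<in> {- int n - 4..0})"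
proof -
  define P :: "nat set" where "P = {0..2 * n + 3}"
  define C where "C = snake_covers w n"
  define q where "q = order_poly C P"
  interpret bounded_graded P C "\<lambda>i. n + 2 - (i + 1) div 2" "2 * n + 3" 0
    unfolding P_def C_def by (rule snake_bounded_graded)
  have L: "snake_ehrhart w = q \<circ>\<^sub>p [:1, 1:]"
    using assms ehrhart_polynomial_order_polytope[OF finite_P, of C] order_polytope_trancl[OF r_subset]
    by (simp add: snake_ehrhart_def snake_carrier_def snake_less_def P_def C_def q_def)
  then have L_poly: "poly (snake_ehrhart w) x = poly q (x + 1)" for x
    by (simp add: poly_pcompose add.commute)
  have sym: "poly q (- of_nat (n + 2) - x) = poly q x" for x
    using arg_cong[OF order_poly_symmetric, of "\<lambda>p. poly p x"]
    by (simp add: q_def P_def poly_pcompose)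
  have L_sym: "poly (snake_ehrhart w) (- of_nat n - 4 - x) = poly (snake_ehrhart w) x" for x
  proof -
    have "- of_nat n - 4 - x + 1 = - of_nat (n + 2) - (x + 1)"
      by simp
    then show ?thesis
      using sym[of "x + 1"] by (simp only: L_poly)
  qed
  have "(\<Prod>k = 1..n + 3. [:of_nat k, 1:]) dvd snake_ehrhart w"
  proof (rule prod_linear_dvd_if_roots)
    fix k assume "k \<in> {1..n + 3}"
    then have "k - 1 \<le> n + 2" and k: "k = Suc (k - 1)"
      by auto
    then have "poly q (- of_nat (k - 1)) = 0"
      unfolding q_def by (intro order_poly_root) simp
    then show "poly (snake_ehrhart w) (- of_nat k) = 0"
      by (subst k) (simp add: L_poly del: of_nat_diff)
  qed (auto simp: inj_on_def)
  moreover have "snake_ehrhart w = snake_ehrhart w \<circ>\<^sub>p [:- of_nat n - 4, - 1:]"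
    by (rule poly_eq_if_eq_on_nats) (simp add: poly_pcompose L_sym)
  moreover have "r \<in> {- int n - 4..0}" if root: "poly (snake_ehrhart w) (of_int r) = 0" for r
  proof -
    have nonzero: "poly (snake_ehrhart w) (of_nat m) \<noteq> 0" for m
    proof -
      have "(\<lambda>i\<in>P. 0) \<in> weak_maps C P (Suc m)"
        by (auto simp: weak_maps_def)
      then have "card (weak_maps C P (Suc m)) \<noteq> 0"
        using finite_weak_maps[OF finite_P] by auto
      then show ?thesis
        using poly_order_poly[OF finite_P, of C "Suc m"] by (simp add: L_poly q_def add.commute)
    qed
    have "\<not> r > 0"
      using nonzero[of "nat r"] root by auto
    moreover have "\<not> r < - int n - 4"
    proof
      assume "r < - int n - 4"
      then have "of_nat (nat (- int n - 4 - r)) = - of_nat n - 4 - (of_int r :: rat)"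
        by simp
      then show False
        using nonzero[of "nat (- int n - 4 - r)"] L_sym[of "of_int r"] root by simp
    qed
    ultimately show ?thesis
      by simp
  qed
  ultimately show ?thesis
    by blast
qed

end
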